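(* The classes $\mathcal{F}$ and $\mathcal{F}_H^0$ have the same radius of starlikeness.
   Context: $\mathbb{D}=\{z\in\mathbb{C}:|z|<1\}$. $\mathcal{F}$ is the class of analytic functions $F$ in $\mathbb{D}$ with $F(0)=0$, $F'(0)=1$ and $|F'(z)-1|<1$ for all $z\in\mathbb{D}$. $\mathcal{F}_H^0$ is the class of all complex-valued harmonic functions $f$ in $\mathbb{D}$ with $f(0)=0$, $f_z(0)=1$, $f_{\bar z}(0)=0$ and $|f_z(z)-1|<1-|f_{\bar z}(z)|$ for all $z\in\mathbb{D}$. A function $f$ in one of these classes is called starlike in $|z|<\rho$ if $\frac{\partial}{\partial\theta}\arg f(re^{i\theta})>0$ for all $0<r<\rho$ and $0\le\theta\le2\pi$. The radius of starlikeness of a class is the largest $\rho\in(0,1]$ such that every function in the class is starlike in $|z|<\rho$. *)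

theory Defs
  imports "HOL-Complex_Analysis.Complex_Analysis"
begin

definition deriv_x :: "(complex \<Rightarrow> complex) \<Rightarrow> complex \<Rightarrow> complex" where
  "deriv_x f z = frechet_derivative f (at z) 1"

definition deriv_y :: "(complex \<Rightarrow> complex) \<Rightarrow> complex \<Rightarrow> complex" where
  "deriv_y f z = frechet_derivative f (at z) \<i>"

text \<open>Wirtinger derivatives.\<close>

definition deriv_z :: "(complex \<Rightarrow> complex) \<Rightarrow> complex \<Rightarrow> complex" where
  "deriv_z f z = (deriv_x f z - \<i> * deriv_y f z) / 2"

definition deriv_zbar :: "(complex \<Rightarrow> complex) \<Rightarrow> complex \<Rightarrow> complex" where
  "deriv_zbar f z = (deriv_x f z + \<i> * deriv_y f z) / 2"

text \<open>
  Twice continuously differentiable in the real sense. Here \<open>differentiable_on\<close> is the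
  real (Frechet) notion on \<open>complex\<close> as a two-dimensional real vector space; \<open>U\<close> is meant
  to be open.
\<close>

definition C2_on :: "(complex \<Rightarrow> complex) \<Rightarrow> complex set \<Rightarrow> bool" where
  "C2_on f U \<longleftrightarrow>
     f differentiable_on U \<and>
     deriv_x f differentiable_on U \<and> deriv_y f differentiable_on U \<and>
     continuous_on U (deriv_x (deriv_x f)) \<and> continuous_on U (deriv_y (deriv_x f)) \<and>
     continuous_on U (deriv_x (deriv_y f)) \<and> continuous_on U (deriv_y (deriv_y f))"

definition harmonic_on :: "(complex \<Rightarrow> complex) \<Rightarrow> complex set \<Rightarrow> bool" where
  "harmonic_on f U \<longleftrightarrow>
     C2_on f U \<and> (\<forall>z\<in>U. deriv_x (deriv_x f) z + deriv_y (deriv_y f) z = 0)"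

definition class_F :: "(complex \<Rightarrow> complex) set" where
  "class_F = {F. F holomorphic_on ball 0 1 \<and> F 0 = 0 \<and> deriv F 0 = 1 \<and>
     (\<forall>z\<in>ball 0 1. cmod (deriv F z - 1) < 1)}"

definition class_FH0 :: "(complex \<Rightarrow> complex) set" where
  "class_FH0 = {f. harmonic_on f (ball 0 1) \<and> f 0 = 0 \<and> deriv_z f 0 = 1 \<and> deriv_zbar f 0 = 0 \<and>
     (\<forall>z\<in>ball 0 1. cmod (deriv_z f z - 1) < 1 - cmod (deriv_zbar f z))}"

text \<open>
  The derivative of the multivalued argument of \<open>g\<close> at \<open>t\<close>: the derivative of a branch
  \<open>\<phi>\<close> of the argument defined near \<open>t\<close>. Differentiability makes \<open>\<phi>\<close> continuous at \<open>t\<close>, so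
  that \<open>d\<close> does not depend on the branch. The argument of 0 is undefined, whereas
  \<open>is_Arg 0\<close> holds of every real; hence the explicit requirement \<open>g t \<noteq> 0\<close>.
\<close>

definition has_arg_derivative :: "(real \<Rightarrow> complex) \<Rightarrow> real \<Rightarrow> real \<Rightarrow> bool" where
  "has_arg_derivative g d t \<longleftrightarrow>
     g t \<noteq> 0 \<and>
     (\<exists>\<phi>. (\<forall>\<^sub>F s in nhds t. is_Arg (g s) (\<phi> s)) \<and> (\<phi> has_real_derivative d) (at t))"

definition starlike_in_disc :: "(complex \<Rightarrow> complex) \<Rightarrow> real \<Rightarrow> bool" where
  "starlike_in_disc f \<rho> \<longleftrightarrow>
     (\<forall>r \<theta>. 0 < r \<and> r < \<rho> \<and> 0 \<le> \<theta> \<and> \<theta> \<le> 2 * pi \<longrightarrow>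
        (\<exists>d>0. has_arg_derivative (\<lambda>t. f (of_real r * cis t)) d \<theta>))"

definition is_radius_of_starlikeness :: "(complex \<Rightarrow> complex) set \<Rightarrow> real \<Rightarrow> bool" where
  "is_radius_of_starlikeness \<F> \<rho> \<longleftrightarrow>
     (0 < \<rho> \<and> \<rho> \<le> 1 \<and> (\<forall>f\<in>\<F>. starlike_in_disc f \<rho>)) \<and>
     (\<forall>\<sigma>. 0 < \<sigma> \<and> \<sigma> \<le> 1 \<and> (\<forall>f\<in>\<F>. starlike_in_disc f \<sigma>) \<longrightarrow> \<sigma> \<le> \<rho>)"

end

theory Submission
  imports Defs
begin

text \<open>
  On the disc a harmonic function is \<open>f = h + cnj g\<close> with \<open>h\<close>, \<open>g\<close> holomorphic, where \<open>h'\<close> and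
  \<open>g'\<close> are \<open>f\<^sub>z\<close> and the conjugate of the other Wirtinger derivative
  (\<open>harmonic_on_decomposition\<close>). The bound that defines the harmonic class then says exactly
  what is needed for every \<open>h + c g\<close> with \<open>|c| \<le> 1\<close> to belong to the analytic class
  (\<open>class_FH0_decomposition\<close>).

  Starlikeness is a pointwise condition: at each \<open>z \<noteq> 0\<close> of the disc in question,
  \<open>Re ((z h' - cnj (z g')) cnj (h + cnj g)) > 0\<close> (\<open>starlike_in_disc_iff\<close>). So suppose that all
  functions \<open>h + c g\<close> satisfy their own, analytic, condition at \<open>z\<close>, and put \<open>a = h z\<close>, \<open>b = g z\<close>,
  \<open>A = z h' z\<close>, \<open>B = z g' z\<close>, \<open>P = Re (A cnj a)\<close>, \<open>Q = Re (B cnj b)\<close>. Choosing the worst \<open>c\<close> on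
  the unit circle gives \<open>P + Q > |B cnj a + b cnj A|\<close>, while the harmonic condition follows from
  \<open>P - Q > |A b - B a|\<close>. Squared, these two inequalities are equivalent, because their squared
  left-hand sides differ by the same quantity as their squared right-hand sides:
  \<open>(P + Q)\<^sup>2 - (P - Q)\<^sup>2 = 4 P Q = |B cnj a + b cnj A|\<^sup>2 - |A b - B a|\<^sup>2\<close>.
  The numbers \<open>c\<close> inside the disc settle the sign of \<open>P - Q\<close>
  (\<open>Re_pos_conjugate_of_Re_pos_rotations\<close>).

  Hence starlikeness of the whole analytic class in \<open>|z| < \<rho>\<close> passes to the harmonic class, and
  it passes back because the analytic class is contained in the harmonic one. The two classes
  therefore have the same set of admissible \<open>\<rho>\<close>. This set has a largest element: it is
  non-empty, as it contains 1/3 by the Schwarz lemma, and it contains its supremum, since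
  starlikeness in \<open>|z| < \<rho>\<close> only concerns circles of radius strictly less than \<open>\<rho>\<close>.
\<close>

section \<open>Symmetry of mixed directional derivatives\<close>

text \<open>
  The mean value theorem needs a real-valued function, so the values are tested against a fixed
  vector \<open>e\<close>. It is applied first in direction \<open>a\<close>, to a difference in direction \<open>b\<close>, and then
  to the derivative along \<open>a\<close>.
\<close>

lemma second_difference_mean_value:
  fixes f :: "'a::real_normed_vector \<Rightarrow> 'b::real_inner"
  assumes t: "0 < t"
    and f: "\<And>x y. 0 \<le> x \<Longrightarrow> x \<le> t \<Longrightarrow> 0 \<le> y \<Longrightarrow> y \<le> t \<Longrightarrow>
      (f has_derivative F (z + x *\<^sub>R a + y *\<^sub>R b)) (at (z + x *\<^sub>R a + y *\<^sub>R b))"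
    and Fa: "\<And>x y. 0 \<le> x \<Longrightarrow> x \<le> t \<Longrightarrow> 0 \<le> y \<Longrightarrow> y \<le> t \<Longrightarrow>
      ((\<lambda>w. F w a) has_derivative G (z + x *\<^sub>R a + y *\<^sub>R b)) (at (z + x *\<^sub>R a + y *\<^sub>R b))"
  obtains x y where "0 \<le> x" "x \<le> t" "0 \<le> y" "y \<le> t"
    "(f (z + t *\<^sub>R a + t *\<^sub>R b) - f (z + t *\<^sub>R a) - f (z + t *\<^sub>R b) + f z) \<bullet> e
      = t\<^sup>2 * (G (z + x *\<^sub>R a + y *\<^sub>R b) b \<bullet> e)"
proof -
  define \<phi> where "\<phi> x = f (z + x *\<^sub>R a + t *\<^sub>R b) \<bullet> e - f (z + x *\<^sub>R a + 0 *\<^sub>R b) \<bullet> e" for x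
  have d\<phi>: "(\<phi> has_real_derivative
      (F (z + x *\<^sub>R a + t *\<^sub>R b) a \<bullet> e - F (z + x *\<^sub>R a + 0 *\<^sub>R b) a \<bullet> e)) (at x)"
    if "0 \<le> x" "x \<le> t" for x
  proof -
    have *: "((\<lambda>x. f (z + x *\<^sub>R a + y *\<^sub>R b) \<bullet> e) has_real_derivative
        F (z + x *\<^sub>R a + y *\<^sub>R b) a \<bullet> e) (at x)" if y: "0 \<le> y" "y \<le> t" for y
    proof -
      have "((\<lambda>x. z + x *\<^sub>R a + y *\<^sub>R b) has_derivative (\<lambda>k. k *\<^sub>R a)) (at x)"
        by (auto intro!: derivative_eq_intros)
      from has_derivative_compose[OF this f[OF \<open>0 \<le> x\<close> \<open>x \<le> t\<close> y]]
      have "((\<lambda>x. f (z + x *\<^sub>R a + y *\<^sub>R b)) has_derivative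
          (\<lambda>k. F (z + x *\<^sub>R a + y *\<^sub>R b) (k *\<^sub>R a))) (at x)" .
      moreover have "F (z + x *\<^sub>R a + y *\<^sub>R b) (k *\<^sub>R a) = k *\<^sub>R F (z + x *\<^sub>R a + y *\<^sub>R b) a" for k
        using has_derivative_linear[OF f[OF \<open>0 \<le> x\<close> \<open>x \<le> t\<close> y]] by (rule linear_cmul)
      ultimately have "((\<lambda>x. f (z + x *\<^sub>R a + y *\<^sub>R b) \<bullet> e) has_derivative
          (\<lambda>k. (k *\<^sub>R F (z + x *\<^sub>R a + y *\<^sub>R b) a) \<bullet> e)) (at x)"
        by (intro has_derivative_inner_left) simp
      then show ?thesis
        by (simp add: has_field_derivative_def mult_commute_abs)
    qed
    show ?thesis
      unfolding \<phi>_def using t by (intro derivative_intros * ) auto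
  qed
  from MVT2[OF t d\<phi>] obtain x where x: "0 < x" "x < t"
    and \<phi>: "\<phi> t - \<phi> 0 = t * (F (z + x *\<^sub>R a + t *\<^sub>R b) a \<bullet> e - F (z + x *\<^sub>R a + 0 *\<^sub>R b) a \<bullet> e)"
    by auto
  define \<psi> where "\<psi> y = F (z + x *\<^sub>R a + y *\<^sub>R b) a \<bullet> e" for y
  have d\<psi>: "(\<psi> has_real_derivative G (z + x *\<^sub>R a + y *\<^sub>R b) b \<bullet> e) (at y)"
    if y: "0 \<le> y" "y \<le> t" for y
  proof -
    have x': "0 \<le> x" "x \<le> t" using x by auto
    have "((\<lambda>y. z + x *\<^sub>R a + y *\<^sub>R b) has_derivative (\<lambda>k. k *\<^sub>R b)) (at y)"
      by (auto intro!: derivative_eq_intros)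
    from has_derivative_compose[OF this Fa[OF x' y]]
    have "((\<lambda>y. F (z + x *\<^sub>R a + y *\<^sub>R b) a) has_derivative
        (\<lambda>k. G (z + x *\<^sub>R a + y *\<^sub>R b) (k *\<^sub>R b))) (at y)" .
    moreover have "G (z + x *\<^sub>R a + y *\<^sub>R b) (k *\<^sub>R b) = k *\<^sub>R G (z + x *\<^sub>R a + y *\<^sub>R b) b" for k
      using has_derivative_linear[OF Fa[OF x' y]] by (rule linear_cmul)
    ultimately have "(\<psi> has_derivative (\<lambda>k. (k *\<^sub>R G (z + x *\<^sub>R a + y *\<^sub>R b) b) \<bullet> e)) (at y)"
      unfolding \<psi>_def by (intro has_derivative_inner_left) simp
    then show ?thesis
      by (simp add: has_field_derivative_def mult_commute_abs)
  qed
  from MVT2[OF t d\<psi>] obtain y where y: "0 < y" "y < t"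
    and \<psi>: "\<psi> t - \<psi> 0 = t * (G (z + x *\<^sub>R a + y *\<^sub>R b) b \<bullet> e)"
    by auto
  have "\<phi> t - \<phi> 0 = t\<^sup>2 * (G (z + x *\<^sub>R a + y *\<^sub>R b) b \<bullet> e)"
    using \<phi> \<psi> by (simp add: \<psi>_def power2_eq_square)
  moreover have "\<phi> t - \<phi> 0
      = (f (z + t *\<^sub>R a + t *\<^sub>R b) - f (z + t *\<^sub>R a) - f (z + t *\<^sub>R b) + f z) \<bullet> e"
    by (simp add: \<phi>_def inner_diff_left inner_add_left)
  ultimately show ?thesis
    using x y by (intro that[of x y]) auto
qed

text \<open>
  The second difference over a small parallelogram is symmetric in the two directions, whereas
  the mean value form approximates it by either of the mixed derivatives at \<open>z\<close>. Testing
  against the supposed discrepancy \<open>e\<close> of the two turns this into a contradiction.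
\<close>

lemma mixed_derivatives_commute:
  fixes f :: "'a::real_normed_vector \<Rightarrow> 'b::real_inner"
  assumes S: "open S" "z \<in> S"
    and f: "\<And>w. w \<in> S \<Longrightarrow> (f has_derivative F w) (at w)"
    and Fa: "\<And>w. w \<in> S \<Longrightarrow> ((\<lambda>w. F w a) has_derivative A w) (at w)"
    and Fb: "\<And>w. w \<in> S \<Longrightarrow> ((\<lambda>w. F w b) has_derivative B w) (at w)"
    and contA: "continuous_on S (\<lambda>w. A w b)" and contB: "continuous_on S (\<lambda>w. B w a)"
  shows "A z b = B z a"
proof (rule ccontr)
  assume ne: "A z b \<noteq> B z a"
  define e where "e = A z b - B z a"
  define \<epsilon> where "\<epsilon> = (e \<bullet> e) / 2"
  have "\<epsilon> > 0" using ne by (simp add: e_def \<epsilon>_def)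
  have cont: "isCont (\<lambda>w. A w b \<bullet> e) z" "isCont (\<lambda>w. B w a \<bullet> e) z"
    using contA contB S by (auto intro!: continuous_intros simp: continuous_on_eq_continuous_at)
  obtain d1 where d1: "d1 > 0" "\<And>w. dist w z < d1 \<Longrightarrow> \<bar>A w b \<bullet> e - A z b \<bullet> e\<bar> < \<epsilon>"
    using cont(1) \<open>\<epsilon> > 0\<close> unfolding continuous_at_eps_delta dist_real_def by blast
  obtain d2 where d2: "d2 > 0" "\<And>w. dist w z < d2 \<Longrightarrow> \<bar>B w a \<bullet> e - B z a \<bullet> e\<bar> < \<epsilon>"
    using cont(2) \<open>\<epsilon> > 0\<close> unfolding continuous_at_eps_delta dist_real_def by blast
  obtain d3 where d3: "d3 > 0" "ball z d3 \<subseteq> S"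
    using S open_contains_ball by blast
  define d where "d = min d1 (min d2 d3)"
  have "d > 0" using d1 d2 d3 by (simp add: d_def)
  \<comment> \<open>The side is chosen so that the whole parallelogram lies within \<open>d\<close> of \<open>z\<close>; the summand 1
    keeps the denominator positive when both directions vanish.\<close>
  define t where "t = d / (norm a + norm b + 1)"
  have nab: "norm a + norm b + 1 > 0" by (intro add_nonneg_pos) auto
  then have t: "t > 0" using \<open>d > 0\<close> by (simp add: t_def)
  have near: "dist (z + x *\<^sub>R a + y *\<^sub>R b) z < d"
    if "0 \<le> x" "x \<le> t" "0 \<le> y" "y \<le> t" for x y
  proof -
    have "dist (z + x *\<^sub>R a + y *\<^sub>R b) z = norm (x *\<^sub>R a + y *\<^sub>R b)"
      by (simp add: dist_norm add.assoc)
    also have "\<dots> \<le> x * norm a + y * norm b"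
      using norm_triangle_ineq[of "x *\<^sub>R a" "y *\<^sub>R b"] that by simp
    also have "\<dots> \<le> t * norm a + t * norm b"
      using that by (intro add_mono mult_right_mono) auto
    also have "\<dots> < t * (norm a + norm b + 1)"
      using t by (simp add: algebra_simps)
    also have "\<dots> = d" using nab by (simp add: t_def)
    finally show ?thesis .
  qed
  then have near': "z + x *\<^sub>R a + y *\<^sub>R b \<in> S" "z + y *\<^sub>R b + x *\<^sub>R a \<in> S"
    if "0 \<le> x" "x \<le> t" "0 \<le> y" "y \<le> t" for x y
    using d3(2) that by (auto simp: d_def dist_commute subset_iff add_ac)
  have dir:
    "(f has_derivative F (z + x *\<^sub>R a + y *\<^sub>R b)) (at (z + x *\<^sub>R a + y *\<^sub>R b))"
    "(f has_derivative F (z + y *\<^sub>R b + x *\<^sub>R a)) (at (z + y *\<^sub>R b + x *\<^sub>R a))"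
    "((\<lambda>w. F w a) has_derivative A (z + x *\<^sub>R a + y *\<^sub>R b)) (at (z + x *\<^sub>R a + y *\<^sub>R b))"
    "((\<lambda>w. F w b) has_derivative B (z + y *\<^sub>R b + x *\<^sub>R a)) (at (z + y *\<^sub>R b + x *\<^sub>R a))"
    if "0 \<le> x" "x \<le> t" "0 \<le> y" "y \<le> t" for x y
    using f Fa Fb near'[OF that] by auto
  obtain x y where xy: "0 \<le> x" "x \<le> t" "0 \<le> y" "y \<le> t"
    and 1: "(f (z + t *\<^sub>R a + t *\<^sub>R b) - f (z + t *\<^sub>R a) - f (z + t *\<^sub>R b) + f z) \<bullet> e
      = t\<^sup>2 * (A (z + x *\<^sub>R a + y *\<^sub>R b) b \<bullet> e)"
    using second_difference_mean_value[where f = f and F = F and G = A and e = e, OF t dir(1) dir(3)]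
    by blast
  obtain y' x' where xy': "0 \<le> x'" "x' \<le> t" "0 \<le> y'" "y' \<le> t"
    and 2: "(f (z + t *\<^sub>R b + t *\<^sub>R a) - f (z + t *\<^sub>R b) - f (z + t *\<^sub>R a) + f z) \<bullet> e
      = t\<^sup>2 * (B (z + y' *\<^sub>R b + x' *\<^sub>R a) a \<bullet> e)"
    using second_difference_mean_value[where f = f and F = F and G = B and a = b and b = a and e = e,
        OF t dir(2) dir(4)]
    by blast
  have swap: "f (z + t *\<^sub>R a + t *\<^sub>R b) - f (z + t *\<^sub>R a) - f (z + t *\<^sub>R b) + f z
      = f (z + t *\<^sub>R b + t *\<^sub>R a) - f (z + t *\<^sub>R b) - f (z + t *\<^sub>R a) + f z"
    by (simp add: algebra_simps)
  have "t\<^sup>2 * (A (z + x *\<^sub>R a + y *\<^sub>R b) b \<bullet> e) = t\<^sup>2 * (B (z + y' *\<^sub>R b + x' *\<^sub>R a) a \<bullet> e)"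
    using 1 2 swap by metis
  then have "A (z + x *\<^sub>R a + y *\<^sub>R b) b \<bullet> e = B (z + y' *\<^sub>R b + x' *\<^sub>R a) a \<bullet> e"
    using t by simp
  moreover have "z + y' *\<^sub>R b + x' *\<^sub>R a = z + x' *\<^sub>R a + y' *\<^sub>R b"
    by (simp add: add_ac)
  ultimately have eq: "A (z + x *\<^sub>R a + y *\<^sub>R b) b \<bullet> e = B (z + x' *\<^sub>R a + y' *\<^sub>R b) a \<bullet> e"
    by simp
  have "\<bar>A (z + x *\<^sub>R a + y *\<^sub>R b) b \<bullet> e - A z b \<bullet> e\<bar> < \<epsilon>"
    using near[OF xy] d1 by (simp add: d_def)
  moreover have "\<bar>B (z + x' *\<^sub>R a + y' *\<^sub>R b) a \<bullet> e - B z a \<bullet> e\<bar> < \<epsilon>"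
    using near[OF xy'] d2 by (simp add: d_def)
  ultimately have "A z b \<bullet> e - B z a \<bullet> e < 2 * \<epsilon>"
    using eq by linarith
  then show False
    by (simp add: \<epsilon>_def e_def inner_diff_left inner_diff_right)
qed

section \<open>Decomposition of planar harmonic functions\<close>

lemma has_derivative_deriv_x_deriv_y:
  assumes "f differentiable (at z)"
  shows "(f has_derivative (\<lambda>k. of_real (Re k) * deriv_x f z + of_real (Im k) * deriv_y f z)) (at z)"
proof -
  have d: "(f has_derivative frechet_derivative f (at z)) (at z)"
    using assms by (simp add: frechet_derivative_works)
  then interpret linear "frechet_derivative f (at z)" by (rule has_derivative_linear)
  have "frechet_derivative f (at z) k = of_real (Re k) * deriv_x f z + of_real (Im k) * deriv_y f z" for k
  proof -
    have "k = Re k *\<^sub>R 1 + Im k *\<^sub>R \<i>" by (simp add: complex_eq_iff)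
    then have "frechet_derivative f (at z) k = frechet_derivative f (at z) (Re k *\<^sub>R 1 + Im k *\<^sub>R \<i>)"
      by (rule arg_cong)
    also have "\<dots> = of_real (Re k) * deriv_x f z + of_real (Im k) * deriv_y f z"
      by (simp only: add scale) (simp add: deriv_x_def deriv_y_def scaleR_conv_of_real)
    finally show ?thesis .
  qed
  then have "frechet_derivative f (at z)
      = (\<lambda>k. of_real (Re k) * deriv_x f z + of_real (Im k) * deriv_y f z)" ..
  with d show ?thesis by simp
qed

text \<open>
  The Cauchy-Riemann equation \<open>D \<i> = \<i> * D 1\<close> makes the real-linear map \<open>D\<close> complex-linear.
\<close>

lemma cauchy_riemann_has_field_derivative:
  assumes p: "(p has_derivative D) (at z)" and CR: "D \<i> = \<i> * D 1"
  shows "(p has_field_derivative D 1) (at z)"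
proof -
  interpret linear D using p by (rule has_derivative_linear)
  have "D k = D 1 * k" for k
  proof -
    have "k = Re k *\<^sub>R 1 + Im k *\<^sub>R \<i>" by (simp add: complex_eq_iff)
    then have "D k = D (Re k *\<^sub>R 1 + Im k *\<^sub>R \<i>)" by (rule arg_cong)
    also have "\<dots> = Re k *\<^sub>R D 1 + Im k *\<^sub>R (\<i> * D 1)" by (simp only: add scale CR)
    also have "\<dots> = D 1 * k" by (simp add: complex_eq_iff algebra_simps)
    finally show ?thesis .
  qed
  then have "D = (*) (D 1)" ..
  with p show ?thesis by (simp add: has_field_derivative_def)
qed

text \<open>
  For \<open>f\<^sub>z\<close>, and likewise for the conjugate of the other Wirtinger derivative, the
  Cauchy-Riemann equation splits into two parts: Laplace's equation and the equality of the
  mixed second derivatives. Both functions therefore have holomorphic primitives on a convex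
  domain, and \<open>f\<close> minus the sum of the first primitive and the conjugate of the second one has
  derivative zero. The constant left over is moved into \<open>h\<close>, together with the normalisation
  of \<open>g\<close>.
\<close>

lemma harmonic_on_decomposition:
  assumes harm: "harmonic_on f S" and S: "open S" "convex S" and w0: "w\<^sub>0 \<in> S"
  obtains h g where "h holomorphic_on S" "g holomorphic_on S" "g w\<^sub>0 = 0"
    "\<And>z. z \<in> S \<Longrightarrow> f z = h z + cnj (g z)"
    "\<And>z. z \<in> S \<Longrightarrow> deriv h z = deriv_z f z"
    "\<And>z. z \<in> S \<Longrightarrow> deriv g z = cnj (deriv_zbar f z)"
proof -
  define X where "X = deriv_x f"
  define Y where "Y = deriv_y f"
  have diff: "f differentiable (at w)" "X differentiable (at w)" "Y differentiable (at w)"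
    if "w \<in> S" for w
    using harm S that
    by (auto simp: harmonic_on_def C2_on_def X_def Y_def differentiable_on_eq_differentiable_at)
  have mixed: "deriv_y X w = deriv_x Y w" if w: "w \<in> S" for w
  proof -
    have "frechet_derivative X (at w) \<i> = frechet_derivative Y (at w) 1"
    proof (rule mixed_derivatives_commute[OF S(1) w, where f = f
          and F = "\<lambda>w. frechet_derivative f (at w)" and a = 1 and b = \<i>])
      fix v assume v: "v \<in> S"
      show "(f has_derivative frechet_derivative f (at v)) (at v)"
        using diff(1)[OF v] by (simp add: frechet_derivative_works)
      show "((\<lambda>w. frechet_derivative f (at w) 1) has_derivative frechet_derivative X (at v)) (at v)"
        using diff(2)[OF v] by (simp add: frechet_derivative_works X_def deriv_x_def[abs_def])
      show "((\<lambda>w. frechet_derivative f (at w) \<i>) has_derivative frechet_derivative Y (at v)) (at v)"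
        using diff(3)[OF v] by (simp add: frechet_derivative_works Y_def deriv_y_def[abs_def])
    next
      show "continuous_on S (\<lambda>w. frechet_derivative X (at w) \<i>)"
        using harm by (simp add: harmonic_on_def C2_on_def X_def deriv_y_def[abs_def])
      show "continuous_on S (\<lambda>w. frechet_derivative Y (at w) 1)"
        using harm by (simp add: harmonic_on_def C2_on_def Y_def deriv_x_def[abs_def])
    qed
    then show ?thesis by (simp add: deriv_x_def deriv_y_def)
  qed
  have laplace: "deriv_y Y w = - deriv_x X w" if "w \<in> S" for w
    using harm that by (auto simp: harmonic_on_def X_def Y_def add_eq_0_iff)
  have "(deriv_z f has_field_derivative (deriv_x X w - \<i> * deriv_x Y w) / 2) (at w)" if w: "w \<in> S" for w
  proof -
    have "((\<lambda>w. (X w - \<i> * Y w) / 2) has_derivative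
        (\<lambda>k. ((of_real (Re k) * deriv_x X w + of_real (Im k) * deriv_y X w)
          - \<i> * (of_real (Re k) * deriv_x Y w + of_real (Im k) * deriv_y Y w)) / 2)) (at w)"
      by (intro bounded_linear.has_derivative[OF bounded_linear_divide] has_derivative_diff
          has_derivative_mult_right has_derivative_deriv_x_deriv_y diff w)
    from cauchy_riemann_has_field_derivative[OF this] show ?thesis
      by (simp add: deriv_z_def[abs_def] mixed[OF w] laplace[OF w] X_def[symmetric] Y_def[symmetric]
          field_simps)
  qed
  then have holz: "deriv_z f holomorphic_on S"
    using S holomorphic_on_open by blast
  have "((\<lambda>w. cnj (deriv_zbar f w)) has_field_derivative cnj ((deriv_x X w + \<i> * deriv_x Y w) / 2)) (at w)"
    if w: "w \<in> S" for w
  proof -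
    have "((\<lambda>w. cnj ((X w + \<i> * Y w) / 2)) has_derivative
        (\<lambda>k. cnj (((of_real (Re k) * deriv_x X w + of_real (Im k) * deriv_y X w)
          + \<i> * (of_real (Re k) * deriv_x Y w + of_real (Im k) * deriv_y Y w)) / 2))) (at w)"
      by (intro bounded_linear.has_derivative[OF bounded_linear_cnj]
          bounded_linear.has_derivative[OF bounded_linear_divide] has_derivative_add
          has_derivative_mult_right has_derivative_deriv_x_deriv_y diff w)
    from cauchy_riemann_has_field_derivative[OF this] show ?thesis
      by (simp add: deriv_zbar_def[abs_def] mixed[OF w] laplace[OF w] X_def[symmetric] Y_def[symmetric]
          field_simps)
  qed
  then have holzbar: "(\<lambda>w. cnj (deriv_zbar f w)) holomorphic_on S"
    using S holomorphic_on_open by blast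
  obtain h where h: "(h has_field_derivative deriv_z f w) (at w)" if "w \<in> S" for w
    using holomorphic_convex_primitive'[OF S(2,1) holz] S(1) by (metis at_within_open)
  obtain g where g: "(g has_field_derivative cnj (deriv_zbar f w)) (at w)" if "w \<in> S" for w
    using holomorphic_convex_primitive'[OF S(2,1) holzbar] S(1) by (metis at_within_open)
  have "((\<lambda>w. f w - (h w + cnj (g w))) has_derivative (\<lambda>k. 0)) (at w within S)" if w: "w \<in> S" for w
  proof -
    have "((\<lambda>w. f w - (h w + cnj (g w))) has_derivative
        (\<lambda>k. (of_real (Re k) * X w + of_real (Im k) * Y w)
          - (deriv_z f w * k + cnj (cnj (deriv_zbar f w) * k)))) (at w within S)"
      using has_derivative_deriv_x_deriv_y[OF diff(1)[OF w]] h[OF w] g[OF w]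
      unfolding has_field_derivative_def X_def Y_def
      by (intro has_derivative_diff has_derivative_add bounded_linear.has_derivative[OF bounded_linear_cnj])
        (auto intro: has_derivative_at_withinI)
    moreover have "(of_real (Re k) * X w + of_real (Im k) * Y w)
          - (deriv_z f w * k + cnj (cnj (deriv_zbar f w) * k)) = 0" for k
      unfolding deriv_z_def deriv_zbar_def X_def[symmetric] Y_def[symmetric]
      by (simp add: complex_eq_iff field_simps)
    ultimately show ?thesis by simp
  qed
  from has_derivative_zero_constant[OF S(2) this]
  obtain c where c: "\<And>w. w \<in> S \<Longrightarrow> f w - (h w + cnj (g w)) = c" by metis
  have h': "((\<lambda>w. h w + (c + cnj (g w\<^sub>0))) has_field_derivative deriv_z f w) (at w)" if "w \<in> S" for w
    using h[OF that] by (auto intro!: derivative_eq_intros)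
  have g': "((\<lambda>w. g w - g w\<^sub>0) has_field_derivative cnj (deriv_zbar f w)) (at w)" if "w \<in> S" for w
    using g[OF that] by (auto intro!: derivative_eq_intros)
  show ?thesis
  proof (rule that)
    show "(\<lambda>w. h w + (c + cnj (g w\<^sub>0))) holomorphic_on S" "(\<lambda>w. g w - g w\<^sub>0) holomorphic_on S"
      using h' g' S holomorphic_on_open by blast+
    show "f w = h w + (c + cnj (g w\<^sub>0)) + cnj (g w - g w\<^sub>0)" if "w \<in> S" for w
      using c[OF that] by (simp add: algebra_simps)
  qed (use h' g' in \<open>auto intro: DERIV_imp_deriv\<close>)
qed

section \<open>Starlikeness as a pointwise inequality\<close>

text \<open>
  If \<open>\<phi>\<close> is a branch of the argument near \<open>t\<close>, then \<open>\<gamma> s * cis (- \<phi> s)\<close> is real; the derivative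
  of its vanishing imaginary part shows \<open>Im (v * cnj (\<gamma> t)) = d * |\<gamma> t|\<^sup>2\<close>, whichever branch is
  used. Conversely, the quotient \<open>\<gamma> s / \<gamma> t\<close> avoids the branch cut of \<open>Ln\<close> for \<open>s\<close> near \<open>t\<close>, even when
  \<open>\<gamma> t\<close> itself is a negative number, and the imaginary part of its logarithm yields a differentiable branch. The
  inequality on the right also forces \<open>\<gamma> t \<noteq> 0\<close>.
\<close>

lemma positive_arg_derivative_iff:
  assumes \<gamma>: "(\<gamma> has_vector_derivative v) (at t)"
  shows "(\<exists>d>0. has_arg_derivative \<gamma> d t) \<longleftrightarrow> Im (v * cnj (\<gamma> t)) > 0"
proof
  assume "\<exists>d>0. has_arg_derivative \<gamma> d t"
  then obtain d \<phi> where d: "d > 0" and nz: "\<gamma> t \<noteq> 0"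
    and arg: "\<forall>\<^sub>F s in nhds t. is_Arg (\<gamma> s) (\<phi> s)" and \<phi>: "(\<phi> has_real_derivative d) (at t)"
    by (auto simp: has_arg_derivative_def)
  have polar: "\<gamma> s * cis (- \<phi> s) = of_real (cmod (\<gamma> s))" if "is_Arg (\<gamma> s) (\<phi> s)" for s
  proof -
    have "\<gamma> s = of_real (cmod (\<gamma> s)) * cis (\<phi> s)"
      using that by (simp add: is_Arg_def cis_conv_exp)
    then have "\<gamma> s * cis (- \<phi> s) = of_real (cmod (\<gamma> s)) * (cis (\<phi> s) * cis (- \<phi> s))"
      by (metis mult.assoc)
    then show ?thesis by (simp add: cis_mult)
  qed
  have "((\<lambda>s. cis (- \<phi> s)) has_vector_derivative - d *\<^sub>R (\<i> * cis (- \<phi> t))) (at t)"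
    using \<phi> unfolding has_vector_derivative_def has_field_derivative_def
    by (auto intro!: derivative_eq_intros simp: algebra_simps)
  from has_vector_derivative_mult[OF \<gamma> this]
  have "((\<lambda>s. Im (\<gamma> s * cis (- \<phi> s))) has_real_derivative
      Im (\<gamma> t * (- d *\<^sub>R (\<i> * cis (- \<phi> t))) + v * cis (- \<phi> t))) (at t)"
    by (simp only: has_vector_derivative_complex_iff)
  moreover have "((\<lambda>s. Im (\<gamma> s * cis (- \<phi> s))) has_real_derivative 0) (at t)"
  proof -
    have "\<forall>\<^sub>F s in nhds t. Im (\<gamma> s * cis (- \<phi> s)) = 0"
      using arg by eventually_elim (simp only: polar Im_complex_of_real)
    then show ?thesis
      by (subst DERIV_cong_ev[OF refl _ refl, where g = "\<lambda>_. 0"]) auto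
  qed
  ultimately have Im0: "Im (\<gamma> t * (- d *\<^sub>R (\<i> * cis (- \<phi> t))) + v * cis (- \<phi> t)) = 0"
    by (rule DERIV_unique)
  have shift: "\<gamma> t * (- d *\<^sub>R (\<i> * cis (- \<phi> t))) = - d *\<^sub>R (\<i> * (\<gamma> t * cis (- \<phi> t)))"
    by simp
  have pt: "\<gamma> t * cis (- \<phi> t) = of_real (cmod (\<gamma> t))"
    using polar eventually_nhds_x_imp_x[OF arg] .
  have *: "Im (v * cis (- \<phi> t)) = d * cmod (\<gamma> t)"
    using Im0 unfolding shift pt by simp
  have "cnj (\<gamma> t) = of_real (cmod (\<gamma> t)) * cis (- \<phi> t)"
  proof -
    have "\<gamma> t = of_real (cmod (\<gamma> t)) * cis (\<phi> t)"
      using eventually_nhds_x_imp_x[OF arg] by (simp add: is_Arg_def cis_conv_exp)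
    then show ?thesis by (metis cis_cnj complex_cnj_complex_of_real complex_cnj_mult)
  qed
  then have "v * cnj (\<gamma> t) = of_real (cmod (\<gamma> t)) * (v * cis (- \<phi> t))" by simp
  then have "Im (v * cnj (\<gamma> t)) = cmod (\<gamma> t) * (d * cmod (\<gamma> t))"
    using * by (simp only: Im_complex_of_real Re_complex_of_real times_complex.sel)
  then show "Im (v * cnj (\<gamma> t)) > 0"
    using d nz by simp
next
  assume pos: "Im (v * cnj (\<gamma> t)) > 0"
  then have nz: "\<gamma> t \<noteq> 0" by auto
  define \<phi> where "\<phi> s = Arg (\<gamma> t) + Im (Ln (\<gamma> s / \<gamma> t))" for s
  have "((\<lambda>s. \<gamma> s / \<gamma> t) has_vector_derivative v / \<gamma> t) (at t)"
    using \<gamma> by (rule has_vector_derivative_divide)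
  moreover have "(Ln has_field_derivative 1) (at (\<gamma> t / \<gamma> t))"
    using nz has_field_derivative_Ln[of 1] by simp
  ultimately have "((\<lambda>s. Ln (\<gamma> s / \<gamma> t)) has_vector_derivative v / \<gamma> t) (at t)"
    using field_vector_diff_chain_at[of "\<lambda>s. \<gamma> s / \<gamma> t" _ t Ln 1] by (simp add: o_def)
  then have "((\<lambda>s. Im (Ln (\<gamma> s / \<gamma> t))) has_real_derivative Im (v / \<gamma> t)) (at t)"
    by (simp only: has_vector_derivative_complex_iff)
  from DERIV_add[OF DERIV_const[of "Arg (\<gamma> t)"] this]
  have d\<phi>: "(\<phi> has_real_derivative Im (v / \<gamma> t)) (at t)"
    by (simp add: \<phi>_def[abs_def])
  have "(\<gamma> \<longlongrightarrow> \<gamma> t) (nhds t)"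
    using has_vector_derivative_continuous[OF \<gamma>]
    by (simp add: isCont_def tendsto_at_iff_tendsto_nhds)
  then have "\<forall>\<^sub>F s in nhds t. \<gamma> s \<noteq> 0"
    using nz by (rule tendsto_imp_eventually_ne)
  then have "\<forall>\<^sub>F s in nhds t. is_Arg (\<gamma> s) (\<phi> s)"
  proof eventually_elim
    case (elim s)
    define q where "q = \<gamma> s / \<gamma> t"
    have q: "q \<noteq> 0" "\<gamma> s = \<gamma> t * q"
      using nz elim by (auto simp: q_def)
    have "is_Arg q (Im (Ln q))"
      using is_Arg_exp_Im[of "Ln q"] q(1) by simp
    then have "\<gamma> t * q = (of_real (cmod (\<gamma> t)) * exp (\<i> * of_real (Arg (\<gamma> t))))
        * (of_real (cmod q) * exp (\<i> * of_real (Im (Ln q))))"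
      using is_Arg_Arg[OF nz] unfolding is_Arg_def by (intro arg_cong2[where f = "(*)"])
    also have "\<dots> = of_real (cmod (\<gamma> t * q)) * exp (\<i> * of_real (\<phi> s))"
      by (simp add: \<phi>_def q_def[symmetric] norm_mult distrib_left exp_add)
    finally show ?case by (simp add: is_Arg_def q(2))
  qed
  moreover have "Im (v / \<gamma> t) > 0"
    using pos by (simp add: Im_complex_div_gt_0)
  ultimately show "\<exists>d>0. has_arg_derivative \<gamma> d t"
    using d\<phi> nz unfolding has_arg_derivative_def by blast
qed

text \<open>
  The curve \<open>t \<mapsto> f (r cis t)\<close> has the velocity \<open>\<i> (z h' - cnj (z g'))\<close> at \<open>z = r cis t\<close>: the sign
  arises because conjugation turns \<open>\<i>\<close> into \<open>- \<i>\<close>.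
\<close>

lemma starlike_in_disc_iff:
  assumes h: "h holomorphic_on ball 0 1" and g: "g holomorphic_on ball 0 1"
    and f: "\<And>z. z \<in> ball 0 1 \<Longrightarrow> f z = h z + cnj (g z)" and \<rho>: "\<rho> \<le> 1"
  shows "starlike_in_disc f \<rho> \<longleftrightarrow>
    (\<forall>z. 0 < cmod z \<and> cmod z < \<rho> \<longrightarrow>
      Re ((z * deriv h z - cnj (z * deriv g z)) * cnj (h z + cnj (g z))) > 0)"
    (is "_ \<longleftrightarrow> (\<forall>z. _ \<longrightarrow> ?P z)")
proof -
  have *: "(\<exists>d>0. has_arg_derivative (\<lambda>t. f (of_real r * cis t)) d \<theta>) \<longleftrightarrow> ?P (of_real r * cis \<theta>)"
    if r: "0 < r" "r < 1" for r \<theta>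
  proof -
    let ?z = "of_real r * cis \<theta>"
    have in_ball: "of_real r * cis t \<in> ball 0 1" for t
      using r by (simp add: norm_mult)
    have z: "((\<lambda>t. of_real r * cis t) has_vector_derivative \<i> * ?z) (at \<theta>)"
      unfolding has_vector_derivative_def by (auto intro!: derivative_eq_intros simp: algebra_simps)
    have "((\<lambda>t. h (of_real r * cis t)) has_vector_derivative \<i> * ?z * deriv h ?z) (at \<theta>)"
      "((\<lambda>t. g (of_real r * cis t)) has_vector_derivative \<i> * ?z * deriv g ?z) (at \<theta>)"
      using field_vector_diff_chain_at[OF z holomorphic_derivI[OF h open_ball in_ball]]
        field_vector_diff_chain_at[OF z holomorphic_derivI[OF g open_ball in_ball]]
      by (simp_all add: o_def)
    then have "((\<lambda>t. f (of_real r * cis t)) has_vector_derivative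
        \<i> * ?z * deriv h ?z + cnj (\<i> * ?z * deriv g ?z)) (at \<theta>)"
      by (simp only: f[OF in_ball]) (intro derivative_intros)
    moreover have "\<i> * ?z * deriv h ?z + cnj (\<i> * ?z * deriv g ?z)
        = \<i> * (?z * deriv h ?z - cnj (?z * deriv g ?z))"
      by (simp add: algebra_simps)
    moreover have "Im (\<i> * u * c) = Re (u * c)" for u c
      by simp
    ultimately show ?thesis
      by (simp only: positive_arg_derivative_iff f[OF in_ball])
  qed
  show ?thesis
  proof
    assume st: "starlike_in_disc f \<rho>"
    show "\<forall>z. 0 < cmod z \<and> cmod z < \<rho> \<longrightarrow> ?P z"
    proof (intro allI impI)
      fix z assume z: "0 < cmod z \<and> cmod z < \<rho>"
      have pz: "z = of_real (cmod z) * cis (Arg2pi z)"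
        using Arg2pi_eq[of z] by (simp add: cis_conv_exp)
      have "\<exists>d>0. has_arg_derivative (\<lambda>t. f (of_real (cmod z) * cis t)) d (Arg2pi z)"
        using st z Arg2pi[of z] unfolding starlike_in_disc_def by auto
      then show "?P z"
        using *[of "cmod z" "Arg2pi z"] z \<rho> pz by simp
    qed
  next
    assume P: "\<forall>z. 0 < cmod z \<and> cmod z < \<rho> \<longrightarrow> ?P z"
    show "starlike_in_disc f \<rho>"
      unfolding starlike_in_disc_def
    proof (intro allI impI)
      fix r \<theta> assume r: "0 < r \<and> r < \<rho> \<and> 0 \<le> \<theta> \<and> \<theta> \<le> 2 * pi"
      then have "?P (of_real r * cis \<theta>)"
        using P[rule_format, of "of_real r * cis \<theta>"] by (simp add: norm_mult)
      then show "\<exists>d>0. has_arg_derivative (\<lambda>t. f (of_real r * cis t)) d \<theta>"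
        using * r \<rho> by auto
    qed
  qed
qed

section \<open>From all rotations of the co-analytic part to its conjugate\<close>

text \<open>
  With the abbreviations of the proof, the hypothesis for \<open>|c| = t\<close> amounts to
  \<open>t |N| < P + t\<^sup>2 Q\<close>, and the conclusion is implied by \<open>|M| < P - Q\<close>. The identity
  \<open>|N|\<^sup>2 = |M|\<^sup>2 + 4 P Q\<close> converts the case \<open>t = 1\<close> into \<open>|M|\<^sup>2 < (P - Q)\<^sup>2\<close>, which leaves the
  sign of \<open>P - Q\<close> to be found from smaller \<open>t\<close>.
\<close>

lemma Re_pos_conjugate_of_Re_pos_rotations:
  fixes a b A B :: complex
  assumes pos: "\<And>c. cmod c \<le> 1 \<Longrightarrow> Re ((A + c * B) * cnj (a + c * b)) > 0"
  shows "Re ((A - cnj B) * cnj (a + cnj b)) > 0"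
proof -
  define P where "P = Re (A * cnj a)"
  define Q where "Q = Re (B * cnj b)"
  define N where "N = B * cnj a + cnj A * b"
  define M where "M = A * b - B * a"
  have "P > 0" using pos[of 0] by (simp add: P_def)
  have PQ: "t * cmod N < P + t\<^sup>2 * Q" if t: "0 \<le> t" "t \<le> 1" for t
  proof -
    \<comment> \<open>Among all \<open>c\<close> of modulus \<open>t\<close>, this one makes the mixed term \<open>c * N\<close> as negative as
      possible.\<close>
    define c where "c = - of_real t * cnj (sgn N)"
    have cc: "cmod c \<le> t"
      using t by (simp add: c_def norm_mult norm_sgn)
    have cN: "c * N = - of_real (t * cmod N)"
    proof (cases "N = 0")
      case False
      then have "cnj (sgn N) * N = of_real (cmod N)"
        by (simp add: sgn_eq complex_norm_square[symmetric] power2_eq_square field_simps)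
      then show ?thesis by (simp add: c_def mult.assoc)
    qed (simp add: c_def)
    show ?thesis
    proof (cases "N = 0")
      case True
      have "Re ((A + of_real t * B) * cnj (a + of_real t * b)) = P + t\<^sup>2 * Q + t * Re N"
        by (simp add: P_def Q_def N_def algebra_simps power2_eq_square)
      with pos[of "of_real t"] t True show ?thesis by simp
    next
      case False
      then have "cmod c = t"
        using t by (simp add: c_def norm_mult norm_sgn)
      then have "c * cnj c = of_real (t\<^sup>2)"
        by (metis complex_norm_square)
      have "Re ((A + c * B) * cnj (a + c * b)) = P + Re (c * N) + Re ((c * cnj c) * (B * cnj b))"
        by (simp add: P_def N_def algebra_simps)
      also have "\<dots> = P - t * cmod N + t\<^sup>2 * Q"
        using cN \<open>c * cnj c = _\<close> by (simp add: Q_def)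
      finally show ?thesis using pos[of c] cc t by simp
    qed
  qed
  have key: "(cmod N)\<^sup>2 = (cmod M)\<^sup>2 + 4 * P * Q"
    unfolding cmod_power2 P_def Q_def N_def M_def by (simp add: algebra_simps power2_eq_square)
  have N1: "cmod N < P + Q" using PQ[of 1] by simp
  then have "(cmod N)\<^sup>2 < (P + Q)\<^sup>2"
    by (intro power_strict_mono) auto
  then have sq: "(cmod M)\<^sup>2 < (P - Q)\<^sup>2"
    using key by (simp add: power2_eq_square algebra_simps)
  have "Q < P"
  proof (rule ccontr)
    assume "\<not> Q < P"
    then have QP: "P \<le> Q" "Q > 0" using \<open>P > 0\<close> by auto
    \<comment> \<open>For this \<open>t\<close> the two summands of \<open>P + t\<^sup>2 Q\<close> coincide, so that \<open>t |N| < 2 P\<close>, that is,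
      \<open>|N|\<^sup>2 < 4 P Q\<close>, against the identity.\<close>
    define t where "t = sqrt (P / Q)"
    have t: "0 \<le> t" "t \<le> 1" "t\<^sup>2 = P / Q"
      using QP \<open>P > 0\<close> by (auto simp: t_def)
    have "t * cmod N < 2 * P" using PQ[OF t(1,2)] t QP by simp
    then have "(t * cmod N)\<^sup>2 < (2 * P)\<^sup>2"
      using t by (intro power_strict_mono) auto
    then have "P / Q * (cmod N)\<^sup>2 < 4 * P\<^sup>2"
      by (simp add: power_mult_distrib t)
    then have "(cmod N)\<^sup>2 < 4 * P * Q"
      using QP \<open>P > 0\<close> by (simp add: field_simps power2_eq_square)
    with key show False by (smt (verit) zero_le_power2)
  qed
  with sq have "cmod M < P - Q"
    using power2_less_imp_less by force
  moreover have "- Re M \<le> cmod M" using abs_Re_le_cmod[of M] by linarith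
  moreover have "Re ((A - cnj B) * cnj (a + cnj b)) = P - Q + Re M"
    by (simp add: P_def Q_def M_def algebra_simps)
  ultimately show ?thesis by linarith
qed

section \<open>The two classes\<close>

lemma holomorphic_deriv_x_deriv_y:
  assumes F: "F holomorphic_on S" and S: "open S" "z \<in> S"
  shows "deriv_x F z = deriv F z" "deriv_y F z = \<i> * deriv F z"
proof -
  have "(F has_derivative (*) (deriv F z)) (at z)"
    using holomorphic_derivI[OF F S] by (simp add: has_field_derivative_def)
  then have "frechet_derivative F (at z) = (*) (deriv F z)"
    by (metis frechet_derivative_at)
  then show "deriv_x F z = deriv F z" "deriv_y F z = \<i> * deriv F z"
    by (simp_all add: deriv_x_def deriv_y_def)
qed

lemma holomorphic_imp_harmonic_on:
  assumes F: "F holomorphic_on S" and S: "open S"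
  shows "harmonic_on F S"
proof -
  note xy = holomorphic_deriv_x_deriv_y
  have F': "deriv F holomorphic_on S" using F S by (rule holomorphic_deriv)
  have F'': "deriv (deriv F) holomorphic_on S" using F' S by (rule holomorphic_deriv)
  have diff: "u differentiable_on S" if "u holomorphic_on S" for u
    using holomorphic_on_imp_differentiable_on[OF that] .
  have x: "deriv_x F holomorphic_on S"
    using F' by (rule holomorphic_transform) (simp add: xy[OF F S])
  have "(\<lambda>z. \<i> * deriv F z) holomorphic_on S"
    using F' by (intro holomorphic_on_mult holomorphic_on_const)
  then have y: "deriv_y F holomorphic_on S"
    by (rule holomorphic_transform) (simp add: xy[OF F S])
  have dx: "deriv (deriv_x F) z = deriv (deriv F) z" if "z \<in> S" for z
    using S that by (intro complex_derivative_transform_within_open[OF x F'])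
      (auto simp: xy[OF F S])
  have dy: "deriv (deriv_y F) z = \<i> * deriv (deriv F) z" if "z \<in> S" for z
  proof -
    have "deriv (deriv_y F) z = deriv (\<lambda>z. \<i> * deriv F z) z"
      using S that \<open>(\<lambda>z. \<i> * deriv F z) holomorphic_on S\<close>
      by (intro complex_derivative_transform_within_open[OF y]) (auto simp: xy[OF F S])
    also have "\<dots> = \<i> * deriv (deriv F) z"
      using F' S that holomorphic_on_imp_differentiable_at by (intro deriv_cmult) blast
    finally show ?thesis .
  qed
  have snd: "deriv_x (deriv_x F) z = deriv (deriv F) z"
    "deriv_y (deriv_x F) z = \<i> * deriv (deriv F) z"
    "deriv_x (deriv_y F) z = \<i> * deriv (deriv F) z"
    "deriv_y (deriv_y F) z = - deriv (deriv F) z" if "z \<in> S" for z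
    using that by (simp_all add: xy[OF x S] xy[OF y S] dx dy)
  have "continuous_on S (deriv (deriv F))" "continuous_on S (\<lambda>z. \<i> * deriv (deriv F) z)"
    "continuous_on S (\<lambda>z. - deriv (deriv F) z)"
    using holomorphic_on_imp_continuous_on[OF F''] by (auto intro: continuous_intros)
  then show ?thesis
    unfolding harmonic_on_def C2_on_def
    using diff[OF F] diff[OF x] diff[OF y] by (simp add: snd cong: continuous_on_cong)
qed

lemma class_F_subset_class_FH0: "class_F \<subseteq> class_FH0"
proof
  fix F assume "F \<in> class_F"
  then have F: "F holomorphic_on ball 0 1" "F 0 = 0" "deriv F 0 = 1"
    "\<And>z. z \<in> ball 0 1 \<Longrightarrow> cmod (deriv F z - 1) < 1"
    by (auto simp: class_F_def)
  have "deriv_z F z = deriv F z" "deriv_zbar F z = 0" if "z \<in> ball 0 1" for z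
    using holomorphic_deriv_x_deriv_y[OF F(1) open_ball that]
    by (simp_all add: deriv_z_def deriv_zbar_def)
  then show "F \<in> class_FH0"
    using F holomorphic_imp_harmonic_on[OF F(1)] by (simp add: class_FH0_def)
qed

text \<open>
  The bound \<open>|f\<^sub>z - 1| < 1 - |g'|\<close> is preserved by the triangle inequality when \<open>c g\<close> is added to
  \<open>h\<close>. Since \<open>g' 0 = 0\<close>, the normalisation at the origin is unaffected. All \<open>c\<close> of the closed
  disc, not only those of modulus 1, are kept because the sign argument uses them.
\<close>

lemma class_FH0_decomposition:
  assumes "f \<in> class_FH0"
  obtains h g where "h holomorphic_on ball 0 1" "g holomorphic_on ball 0 1"
    "\<And>z. z \<in> ball 0 1 \<Longrightarrow> f z = h z + cnj (g z)"
    "\<And>c. cmod c \<le> 1 \<Longrightarrow> (\<lambda>z. h z + c * g z) \<in> class_F"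
proof -
  have harm: "harmonic_on f (ball 0 1)" and f0: "f 0 = 0" "deriv_z f 0 = 1" "deriv_zbar f 0 = 0"
    and bound: "\<And>z. z \<in> ball 0 1 \<Longrightarrow> cmod (deriv_z f z - 1) < 1 - cmod (deriv_zbar f z)"
    using assms by (auto simp: class_FH0_def)
  obtain h g where h: "h holomorphic_on ball 0 1" and g: "g holomorphic_on ball 0 1" "g 0 = 0"
    and f: "\<And>z. z \<in> ball 0 1 \<Longrightarrow> f z = h z + cnj (g z)"
    and h': "\<And>z. z \<in> ball 0 1 \<Longrightarrow> deriv h z = deriv_z f z"
    and g': "\<And>z. z \<in> ball 0 1 \<Longrightarrow> deriv g z = cnj (deriv_zbar f z)"
    using harmonic_on_decomposition[OF harm open_ball convex_ball, of 0] by auto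
  have "(\<lambda>z. h z + c * g z) \<in> class_F" if c: "cmod c \<le> 1" for c
  proof -
    have d: "deriv (\<lambda>z. h z + c * g z) z = deriv_z f z + c * cnj (deriv_zbar f z)"
      if "z \<in> ball 0 1" for z
      using holomorphic_derivI[OF h open_ball that] holomorphic_derivI[OF g(1) open_ball that]
      by (intro DERIV_imp_deriv) (auto intro!: derivative_eq_intros simp: h'[OF that] g'[OF that])
    have "cmod (deriv_z f z + c * cnj (deriv_zbar f z) - 1) < 1" if "z \<in> ball 0 1" for z
    proof -
      have "cmod (deriv_z f z + c * cnj (deriv_zbar f z) - 1)
          \<le> cmod (deriv_z f z - 1) + cmod (c * cnj (deriv_zbar f z))"
        using norm_triangle_ineq[of "deriv_z f z - 1" "c * cnj (deriv_zbar f z)"]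
        by (simp add: algebra_simps)
      also have "cmod (c * cnj (deriv_zbar f z)) \<le> cmod (deriv_zbar f z)"
        using c by (simp add: norm_mult mult_left_le_one_le)
      finally show ?thesis using bound[OF that] by linarith
    qed
    then show ?thesis
      using h g f0 f[of 0] by (auto simp: class_F_def d intro!: holomorphic_intros)
  qed
  with h g(1) f show ?thesis using that by blast
qed

lemma starlike_class_F_imp_class_FH0:
  assumes \<rho>: "\<rho> \<le> 1" and st: "\<forall>F\<in>class_F. starlike_in_disc F \<rho>" and f: "f \<in> class_FH0"
  shows "starlike_in_disc f \<rho>"
proof -
  obtain h g where h: "h holomorphic_on ball 0 1" and g: "g holomorphic_on ball 0 1"
    and fhg: "\<And>z. z \<in> ball 0 1 \<Longrightarrow> f z = h z + cnj (g z)"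
    and cl: "\<And>c. cmod c \<le> 1 \<Longrightarrow> (\<lambda>z. h z + c * g z) \<in> class_F"
    using class_FH0_decomposition[OF f] by blast
  have "Re ((z * deriv h z - cnj (z * deriv g z)) * cnj (h z + cnj (g z))) > 0"
    if z: "0 < cmod z \<and> cmod z < \<rho>" for z
  proof (rule Re_pos_conjugate_of_Re_pos_rotations)
    fix c :: complex assume c: "cmod c \<le> 1"
    have zb: "z \<in> ball 0 1" using z \<rho> by simp
    have hol: "(\<lambda>z. h z + c * g z) holomorphic_on ball 0 1"
      using h g by (intro holomorphic_intros)
    have "starlike_in_disc (\<lambda>z. h z + c * g z) \<rho>" using st cl[OF c] by blast
    then have "Re (z * deriv (\<lambda>z. h z + c * g z) z * cnj (h z + c * g z)) > 0"
      using starlike_in_disc_iff[OF hol holomorphic_on_const[of 0], of "\<lambda>z. h z + c * g z" \<rho>] z \<rho>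
      by simp
    moreover have "deriv (\<lambda>z. h z + c * g z) z = deriv h z + c * deriv g z"
      using holomorphic_derivI[OF h open_ball zb] holomorphic_derivI[OF g(1) open_ball zb]
      by (intro DERIV_imp_deriv) (auto intro!: derivative_eq_intros)
    ultimately show "0 < Re ((z * deriv h z + c * (z * deriv g z)) * cnj (h z + c * g z))"
      by (simp add: algebra_simps)
  qed
  then show ?thesis
    using starlike_in_disc_iff[OF h g fhg \<rho>] by blast
qed

text \<open>
  By the Schwarz lemma \<open>|F' z - 1| \<le> |z|\<close>, hence for \<open>|z| < 1/3\<close> both \<open>z F' z\<close> and \<open>F z\<close> differ from
  \<open>z\<close> by at most \<open>|z| / 3\<close>. Then \<open>Re (z F' z cnj (F z))\<close> is at least
  \<open>(1 - 1/3 - 1/3 - 1/9) |z|\<^sup>2 > 0\<close>. Any positive radius would serve; 1/3 keeps the estimate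
  elementary.
\<close>

lemma class_F_starlike_third:
  assumes "F \<in> class_F"
  shows "starlike_in_disc F (1/3)"
proof -
  have F: "F holomorphic_on ball 0 1" "F 0 = 0" "deriv F 0 = 1"
    "\<And>z. z \<in> ball 0 1 \<Longrightarrow> cmod (deriv F z - 1) < 1"
    using assms by (auto simp: class_F_def)
  have F': "deriv F holomorphic_on ball 0 1" using F by (intro holomorphic_deriv) auto
  have schwarz: "cmod (deriv F z - 1) \<le> cmod z" if "cmod z < 1" for z
    using that F by (intro Schwarz_Lemma(1)[of "\<lambda>z. deriv F z - 1"]
        holomorphic_on_diff F' holomorphic_on_const) auto
  have "Re (z * deriv F z * cnj (F z)) > 0" if z: "0 < cmod z" "cmod z < 1/3" for z
  proof -
    have "cmod ((F z - z) - (F 0 - 0)) \<le> 1/3 * cmod (z - 0)"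
    proof (rule field_differentiable_bound[where f' = "\<lambda>z. deriv F z - 1"])
      fix w :: complex assume w: "w \<in> ball 0 (1/3)"
      show "((\<lambda>z. F z - z) has_field_derivative deriv F w - 1) (at w within ball 0 (1/3))"
        using w by (intro has_field_derivative_at_within[OF DERIV_diff]
            holomorphic_derivI[OF F(1) open_ball] DERIV_ident) simp
      show "cmod (deriv F w - 1) \<le> 1/3" using schwarz[of w] w by simp
    qed (use z in auto)
    then have F1: "cmod (F z - z) \<le> 1/3 * cmod z" using F(2) by simp
    define u where "u = z * (deriv F z - 1)"
    define v where "v = F z - z"
    have u: "cmod u \<le> 1/3 * cmod z"
      using schwarz[of z] z by (simp add: u_def norm_mult)
    have "z * deriv F z * cnj (F z) = z * cnj z + (z * cnj v + u * cnj z + u * cnj v)"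
      by (simp add: u_def v_def algebra_simps)
    then have "Re (z * deriv F z * cnj (F z)) = (cmod z)\<^sup>2 + Re (z * cnj v + u * cnj z + u * cnj v)"
      using cmod_power2[of z] by (simp add: power2_eq_square)
    moreover have "cmod (z * cnj v + u * cnj z + u * cnj v)
        \<le> cmod z * cmod v + cmod u * cmod z + cmod u * cmod v"
      by (intro norm_triangle_le add_mono) (simp_all add: norm_mult)
    moreover have "\<dots> \<le> cmod z * (1/3 * cmod z) + 1/3 * cmod z * cmod z + 1/3 * cmod z * (1/3 * cmod z)"
      using u F1 by (intro add_mono mult_mono) (auto simp: v_def)
    moreover have "\<dots> < (cmod z)\<^sup>2"
      using z by (simp add: power2_eq_square)
    ultimately show ?thesis
      using abs_Re_le_cmod[of "z * cnj v + u * cnj z + u * cnj v"] by linarith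
  qed
  then show ?thesis
    using starlike_in_disc_iff[OF F(1) holomorphic_on_const[of 0], of F "1/3"] by simp
qed

theorem theorem3p3:
  "\<exists>\<rho>. is_radius_of_starlikeness class_F \<rho> \<and> is_radius_of_starlikeness class_FH0 \<rho>"
proof -
  define R where "R = {\<rho>. 0 < \<rho> \<and> \<rho> \<le> 1 \<and> (\<forall>F\<in>class_F. starlike_in_disc F \<rho>)}"
  have R_H: "R = {\<rho>. 0 < \<rho> \<and> \<rho> \<le> 1 \<and> (\<forall>f\<in>class_FH0. starlike_in_disc f \<rho>)}"
    unfolding R_def using starlike_class_F_imp_class_FH0 class_F_subset_class_FH0 by blast
  have third: "1/3 \<in> R" by (simp add: R_def class_F_starlike_third)
  have bdd: "bdd_above R" by (rule bdd_aboveI[of _ 1]) (simp add: R_def)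
  have "Sup R \<in> R"
  proof -
    have "0 < Sup R" using cSup_upper[OF third bdd] by simp
    moreover have "Sup R \<le> 1"
      using third by (intro cSup_least) (blast, simp add: R_def)
    moreover have "starlike_in_disc F (Sup R)" if F: "F \<in> class_F" for F
      unfolding starlike_in_disc_def
    proof (intro allI impI)
      fix r \<theta> assume r: "0 < r \<and> r < Sup R \<and> 0 \<le> \<theta> \<and> \<theta> \<le> 2 * pi"
      then obtain \<rho> where "\<rho> \<in> R" "r < \<rho>"
        using third less_cSupD[of R r] by auto
      then show "\<exists>d>0. has_arg_derivative (\<lambda>t. F (of_real r * cis t)) d \<theta>"
        using r F by (auto simp: R_def starlike_in_disc_def)
    qed
    ultimately show ?thesis by (simp add: R_def)
  qed
  then have "\<exists>\<rho>. \<rho> \<in> R \<and> (\<forall>\<sigma>\<in>R. \<sigma> \<le> \<rho>)"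
    using cSup_upper[OF _ bdd] by blast
  then obtain \<rho> where \<rho>: "\<rho> \<in> R" "\<And>\<sigma>. \<sigma> \<in> R \<Longrightarrow> \<sigma> \<le> \<rho>" by blast
  have "is_radius_of_starlikeness class_F \<rho>"
    using \<rho> unfolding R_def is_radius_of_starlikeness_def by simp
  moreover have "is_radius_of_starlikeness class_FH0 \<rho>"
    using \<rho> unfolding R_H is_radius_of_starlikeness_def by simp
  ultimately show ?thesis by blast
qed

end
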